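(* Let $\nu\ge1$, let $\alpha$ be a real number and $\beta_1,\ldots,\beta_\nu$ nonzero real numbers. If $\alpha$ can be written as a linear combination with rational coefficients of the numbers $1,1/\beta_1,\ldots,1/\beta_\nu$, then there are continuous functions $f_j:\mathbb{R}\to\mathbb{R}$, $j=1,\ldots,\nu$, with $f_j$ periodic with period $\beta_j$, such that the sequence $n\alpha+f_1(n)+\cdots+f_\nu(n)$, $n=1,2,\ldots$, is not uniformly distributed (mod 1).
   Context: A real sequence $(x_n)_{n\ge1}$ is uniformly distributed (mod 1) if for all $0\le a<b<1$, $\lim_{n\to\infty}\frac1n\#\{1\le k\le n:\{x_k\}\in[a,b]\}=b-a$, where $\{\cdot\}$ denotes fractional part. A function $f$ has period $\beta$ if $f(x+\beta)=f(x)$ for all $x$ ($\beta$ need not be minimal). *)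

theory Defs
  imports "HOL-Analysis.Analysis" "HOL-Library.Periodic_Fun"
begin

(* Sequences are indexed from 1; the value x 0 is irrelevant. *)
definition uniformly_distributed_mod1 :: "(nat \<Rightarrow> real) \<Rightarrow> bool" where
  "uniformly_distributed_mod1 x \<longleftrightarrow>
     (\<forall>a b. 0 \<le> a \<and> a < b \<and> b < 1 \<longrightarrow>
       (\<lambda>n. real (card {k \<in> {1..n}. frac (x k) \<in> {a..b}}) / real n) \<longlonglongrightarrow> b - a)"

end

theory Submission
  imports Defs
begin

text \<open>
  Let \<open>M = \<nu> + 1\<close>. A continuous \<open>1\<close>-periodic sawtooth can agree with the identity modulo \<open>1\<close>
  except on an arc of length \<open>1 / M\<close> (where it drops back), and the \<open>M\<close> rotations of that arc by
  \<open>i / M\<close> are disjoint. Cancelling every term \<open>n q\<^sub>j / \<beta>\<^sub>j\<close> with the \<open>i\<close>-th rotated sawtooth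
  leaves a sequence whose \<open>n\<close>-th term lies in \<open>(1 / N) \<int>\<close>, for a common denominator \<open>N\<close>, as soon
  as no \<open>n / \<beta>\<^sub>j\<close> lies in the \<open>i\<close>-th exceptional arc. Each \<open>j\<close> excludes at most one \<open>i\<close>, so
  every \<open>n\<close> is good for some \<open>i < M\<close>. If all \<open>M\<close> sequences were uniformly distributed, the good
  \<open>n\<close> of each would have density \<open>0\<close>, although together they cover all positive integers.
\<close>

text \<open>Modulo 1 the lattice has only the points \<open>k / N\<close> with \<open>k < N\<close>.
  Short intervals starting at these points catch every term counted here, and by uniform
  distribution their frequencies add up, in the limit, to a total length that can be made
  arbitrarily small.\<close>

lemma uniformly_distributed_mod1_lattice_density_0:
  assumes ud: "uniformly_distributed_mod1 x" and N: "N > 0"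
  shows "(\<lambda>n. real (card {m \<in> {1..n}. real N * x m \<in> \<int>}) / real n) \<longlonglongrightarrow> 0"
proof (rule order_tendstoI)
  fix e :: real assume "e < 0"
  then show "\<forall>\<^sub>F n in sequentially. e < real (card {m \<in> {1..n}. real N * x m \<in> \<int>}) / real n"
    by (intro always_eventually allI) (rule less_le_trans, assumption, simp)
next
  fix e :: real assume e: "e > 0"
  \<comment> \<open>The total length \<open>N * d\<close> must stay below \<open>e\<close>; keeping
    it below 1 as well puts the right end of the last interval, the one for
    \<open>k = N - 1\<close>, strictly below 1, as the definition of uniform distribution
    demands.\<close>
  define d where "d = min (e / 2) (1 / 2) / real N"
  have d: "d > 0" "real N * d < 1" "real N * d < e" using e N by (auto simp: d_def)
  define A where "A k n = {m \<in> {1..n}. frac (x m) \<in> {real k / real N..real k / real N + d}}" for k n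
  have "(\<lambda>n. real (card (A k n)) / real n) \<longlonglongrightarrow> d" if "k < N" for k
  proof -
    have "real k / real N + d < 1"
    proof -
      have "real k + real N * d < real k + 1" using d by simp
      also have "\<dots> \<le> real N" using that by linarith
      finally show ?thesis using N by (simp add: field_simps)
    qed
    with ud d(1) have "(\<lambda>n. real (card (A k n)) / real n) \<longlonglongrightarrow> (real k / real N + d) - real k / real N"
      unfolding uniformly_distributed_mod1_def A_def
      by (elim allE[of _ "real k / real N"] allE[of _ "real k / real N + d"]) auto
    then show ?thesis by simp
  qed
  then have "(\<lambda>n. \<Sum>k<N. real (card (A k n)) / real n) \<longlonglongrightarrow> (\<Sum>k<N. d)"
    by (intro tendsto_sum) auto
  then have "\<forall>\<^sub>F n in sequentially. (\<Sum>k<N. real (card (A k n)) / real n) < e"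
    using d(3) by (auto dest: order_tendstoD(2))
  then show "\<forall>\<^sub>F n in sequentially. real (card {m \<in> {1..n}. real N * x m \<in> \<int>}) / real n < e"
  proof (rule eventually_mono)
    fix n assume less: "(\<Sum>k<N. real (card (A k n)) / real n) < e"
    have "{m \<in> {1..n}. real N * x m \<in> \<int>} \<subseteq> (\<Union>k<N. A k n)"
    proof
      fix m assume "m \<in> {m \<in> {1..n}. real N * x m \<in> \<int>}"
      then have m: "m \<in> {1..n}" and "real N * x m \<in> \<int>" by auto
      then have "real N * frac (x m) \<in> \<int>"
        unfolding frac_def right_diff_distrib
        by (intro Ints_diff Ints_mult[OF Ints_of_nat Ints_of_int])
      then obtain z where z: "real N * frac (x m) = of_int z" by (auto elim: Ints_cases)
      have "real_of_int z \<ge> 0" unfolding z[symmetric] by simp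
      moreover have "real_of_int z < real N"
        unfolding z[symmetric] using N frac_lt_1[of "x m"] by simp
      ultimately have "nat z < N" "frac (x m) = real (nat z) / real N"
        using z N by (auto simp: field_simps)
      then show "m \<in> (\<Union>k<N. A k n)" using m d(1) by (auto simp: A_def)
    qed
    then have "card {m \<in> {1..n}. real N * x m \<in> \<int>} \<le> card (\<Union>k<N. A k n)"
      by (rule card_mono[rotated]) (auto simp: A_def)
    also have "\<dots> \<le> (\<Sum>k<N. card (A k n))" by (rule card_UN_le) simp
    finally have "real (card {m \<in> {1..n}. real N * x m \<in> \<int>}) \<le> (\<Sum>k<N. real (card (A k n)))"
      unfolding of_nat_sum[symmetric] of_nat_le_iff .
    then have "real (card {m \<in> {1..n}. real N * x m \<in> \<int>}) / real n
        \<le> (\<Sum>k<N. real (card (A k n)) / real n)"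
      unfolding sum_divide_distrib[symmetric] by (rule divide_right_mono) simp
    with less show "real (card {m \<in> {1..n}. real N * x m \<in> \<int>}) / real n < e" by simp
  qed
qed

text \<open>On one period the graph rises with slope 1 and then falls with slope
  \<open>-(M - 1)\<close> back to 0; the two branches cross at
  \<open>frac y = 1 - 1 / M\<close>.\<close>

definition sawtooth :: "nat \<Rightarrow> real \<Rightarrow> real" where
  "sawtooth M y = min (frac y) ((real M - 1) * (1 - frac y))"

lemma sawtooth_add_1: "sawtooth M (y + 1) = sawtooth M y"
  by (simp add: sawtooth_def frac_1_eq)

lemma continuous_sawtooth:
  assumes "M \<ge> 2"
  shows "continuous_on UNIV (sawtooth M)"
proof -
  have "isCont (sawtooth M) y" for y
  proof (cases "y \<in> \<int>")
    case False
    then show ?thesis unfolding sawtooth_def by (intro continuous_intros continuous_frac)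
  next
    case True
    then obtain k where k: "y = of_int k" by (auto elim: Ints_cases)
    define g where "g u = max (u - y) ((real M - 1) * (y - u))" for u
    have "isCont g y" unfolding g_def by (intro continuous_intros)
    moreover have "\<forall>\<^sub>F u in nhds y. sawtooth M u = g u"
    proof -
      have "\<forall>\<^sub>F u in nhds y. u \<in> ball y (1 / real M)"
        using assms by (intro eventually_nhds_in_open) auto
      then show ?thesis
      proof (rule eventually_mono)
        fix u assume "u \<in> ball y (1 / real M)"
        then have u: "\<bar>u - y\<bar> < 1 / real M" by (simp add: dist_real_def)
        have "real M * \<bar>u - y\<bar> < 1" using u assms by (simp add: field_simps)
        then have Mu: "real M * (u - y) < 1" "real M * (y - u) < 1"
          by (auto elim!: le_less_trans[rotated] intro!: mult_left_mono)
        have M: "1 / real M \<le> 1 / 2" using assms by (simp add: field_simps)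
        show "sawtooth M u = g u"
        proof (cases "u \<ge> y")
          case True
          have "frac u = u - y" using True u M k by (intro frac_unique_iff[THEN iffD2]) auto
          moreover have "(real M - 1) * (y - u) \<le> 0"
            using assms True by (intro mult_nonneg_nonpos) auto
          moreover have "u - y \<le> (real M - 1) * (1 - (u - y))"
            using Mu assms by (simp add: algebra_simps)
          ultimately show ?thesis using True by (simp add: sawtooth_def g_def)
        next
          case False
          have "frac u = u - y + 1" using False u M k by (intro frac_unique_iff[THEN iffD2]) auto
          moreover have "(real M - 1) * (y - u) \<ge> 0"
            using assms False by (intro mult_nonneg_nonneg) auto
          moreover have "(real M - 1) * (y - u) \<le> u - y + 1"
            using Mu by (simp add: algebra_simps)
          ultimately show ?thesis using False by (simp add: sawtooth_def g_def)
        qed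
      qed
    qed
    ultimately show ?thesis using isCont_cong by blast
  qed
  then show ?thesis by (simp add: continuous_at_imp_continuous_on)
qed

lemma sawtooth_eq_frac:
  assumes "M > 0" "frac y \<le> 1 - 1 / real M"
  shows "sawtooth M y = frac y"
  using assms by (simp add: sawtooth_def field_simps)

text \<open>If \<open>p\<close> is the integer just above \<open>y - i / M\<close>, the hypothesis
  confines \<open>M * y\<close> strictly between \<open>p * M + i - 1\<close> and
  \<open>p * M + i\<close>. The ceiling of \<open>M * y\<close> is therefore
  \<open>p * M + i\<close>, and its residue modulo \<open>M\<close> recovers
  \<open>i\<close>.\<close>

lemma exceptional_rotation_unique:
  assumes "i < M" and exc: "frac (y - real i / real M) > 1 - 1 / real M"
  shows "i = nat (\<lceil>real M * y\<rceil> mod int M)"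
proof -
  have M: "M > 0" using assms(1) by simp
  define p where "p = \<lfloor>y - real i / real M\<rfloor> + 1"
  have "y - real i / real M > of_int p - 1 / real M" "y - real i / real M < of_int p"
    using exc frac_lt_1[of "y - real i / real M"] by (auto simp: frac_def p_def)
  from this[THEN mult_strict_left_mono, of "real M"]
  have "real M * y > of_int p * real M + real i - 1" "real M * y < of_int p * real M + real i"
    using M by (simp_all add: right_diff_distrib mult.commute)
  then have "\<lceil>real M * y\<rceil> = p * int M + int i" by (intro ceiling_unique) auto
  then show ?thesis using assms(1) by simp
qed

lemma rat_common_denominator:
  fixes q :: "'a \<Rightarrow> rat"
  assumes "finite S"
  shows "\<exists>N>0. \<forall>j\<in>S. real N * of_rat (q j) \<in> \<int>"
  using assms
proof induction
  case empty
  show ?case by (auto intro: exI[of _ 1])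
next
  case (insert a S)
  then obtain N where N: "N > 0" "\<forall>j\<in>S. real N * of_rat (q j) \<in> \<int>" by blast
  obtain m n where q: "q a = Fract m n" and n: "n > 0" by (cases "q a") auto
  have "real (nat n) * of_rat (q a) \<in> \<int>" using n by (simp add: q of_rat_rat)
  then have "real (N * nat n) * of_rat (q j) \<in> \<int>" if "j \<in> insert a S" for j
    using that N(2) Ints_mult[OF Ints_of_nat[of N], of "real (nat n) * of_rat (q j)"]
      Ints_mult[OF Ints_of_nat[of "nat n"], of "real N * of_rat (q j)"]
    by (auto simp: mult_ac)
  then show ?case using N(1) n by (intro exI[of _ "N * nat n"]) auto
qed

theorem proposition5p1:
  fixes \<nu> :: nat and \<alpha> :: real and \<beta> :: "nat \<Rightarrow> real"
  assumes "\<nu> \<ge> 1"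
    and "\<And>j. j \<in> {1..\<nu>} \<Longrightarrow> \<beta> j \<noteq> 0"
    and "\<exists>(q\<^sub>0 :: rat) (q :: nat \<Rightarrow> rat).
           \<alpha> = of_rat q\<^sub>0 * 1 + (\<Sum>j = 1..\<nu>. of_rat (q j) * (1 / \<beta> j))"
  shows "\<exists>f :: nat \<Rightarrow> real \<Rightarrow> real.
           (\<forall>j \<in> {1..\<nu>}. continuous_on UNIV (f j) \<and> periodic_fun_simple (f j) (\<beta> j)) \<and>
           \<not> uniformly_distributed_mod1 (\<lambda>n. real n * \<alpha> + (\<Sum>j = 1..\<nu>. f j (real n)))"
proof -
  from assms(3) obtain q0 :: rat and q :: "nat \<Rightarrow> rat" where
    \<alpha>: "\<alpha> = of_rat q0 + (\<Sum>j = 1..\<nu>. of_rat (q j) / \<beta> j)" by auto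
  obtain N where N: "N > 0" and Nq: "\<forall>r\<in>insert q0 (q ` {1..\<nu>}). real N * of_rat r \<in> \<int>"
    using rat_common_denominator[of "insert q0 (q ` {1..\<nu>})" "\<lambda>r. r"] by auto
  define M where "M = \<nu> + 1"
  have M: "M \<ge> 2" using assms(1) by (simp add: M_def)
  define f where "f i j x = - of_rat (q j) * (sawtooth M (x / \<beta> j - real i / real M) + real i / real M)"
    for i j :: nat and x :: real
  define s where "s i n = real n * \<alpha> + (\<Sum>j = 1..\<nu>. f i j (real n))" for i n :: nat
  have cont: "continuous_on UNIV (f i j)" if "j \<in> {1..\<nu>}" for i j
    unfolding f_def using assms(2)[OF that]
    by (intro continuous_intros continuous_on_compose2[OF continuous_sawtooth[OF M]]) auto
  have per: "periodic_fun_simple (f i j) (\<beta> j)" if "j \<in> {1..\<nu>}" for i j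
  proof
    fix x
    have "(x + \<beta> j) / \<beta> j - real i / real M = (x / \<beta> j - real i / real M) + 1"
      using assms(2)[OF that] by (simp add: field_simps)
    then show "f i j (x + \<beta> j) = f i j x" by (simp only: f_def sawtooth_add_1)
  qed
  define G where "G i = {n. real N * s i n \<in> \<int>}" for i
  have cover: "\<exists>i<M. n \<in> G i" for n
  proof -
    \<comment> \<open>\<open>E\<close> contains every rotation index that is exceptional for some
      \<open>j\<close>; it has at most \<nu> elements, one fewer than the \<open>M\<close> available
      indices.\<close>
    define E where "E = (\<lambda>j. nat (\<lceil>real M * (real n / \<beta> j)\<rceil> mod int M)) ` {1..\<nu>}"
    have "card E \<le> \<nu>" unfolding E_def using card_image_le[of "{1..\<nu>}"] by force
    then have "\<not> {..<M} \<subseteq> E" using card_mono[of E "{..<M}"] by (auto simp: M_def E_def)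
    then obtain i where i: "i < M" "i \<notin> E" by auto
    have "real N * (of_rat (q j) * (real n / \<beta> j) + f i j (real n)) \<in> \<int>" if j: "j \<in> {1..\<nu>}" for j
    proof -
      define z where "z = real n / \<beta> j - real i / real M"
      have "frac z \<le> 1 - 1 / real M"
        using exceptional_rotation_unique[OF i(1), of "real n / \<beta> j"] i(2) j
        unfolding E_def z_def by fastforce
      then have "sawtooth M z = frac z" using M by (intro sawtooth_eq_frac) auto
      then have "of_rat (q j) * (real n / \<beta> j) + f i j (real n) = of_rat (q j) * of_int \<lfloor>z\<rfloor>"
        by (simp add: f_def z_def[symmetric] frac_def) (simp add: z_def algebra_simps)
      then show ?thesis using Nq j Ints_mult[OF _ Ints_of_int, of "real N * of_rat (q j)" "\<lfloor>z\<rfloor>"]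
        by (simp add: mult.assoc)
    qed
    then have "(\<Sum>j = 1..\<nu>. real N * (of_rat (q j) * (real n / \<beta> j) + f i j (real n))) \<in> \<int>"
      by (rule Ints_sum)
    moreover have "real n * (real N * of_rat q0) \<in> \<int>"
    by (rule Ints_mult[OF Ints_of_nat]) (use Nq in simp)
    moreover have "real N * s i n = real n * (real N * of_rat q0)
        + (\<Sum>j = 1..\<nu>. real N * (of_rat (q j) * (real n / \<beta> j) + f i j (real n)))"
      by (simp add: s_def \<alpha> distrib_left sum.distrib sum_distrib_left mult_ac)
    ultimately have "n \<in> G i" by (simp add: G_def)
    with i(1) show ?thesis by blast
  qed
  have "\<exists>i. \<not> uniformly_distributed_mod1 (s i)"
  proof (rule ccontr)
    assume "\<not> ?thesis"
    then have "(\<lambda>n. real (card {m \<in> {1..n}. m \<in> G i}) / real n) \<longlonglongrightarrow> 0" for i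
      using uniformly_distributed_mod1_lattice_density_0[OF _ N, of "s i"] by (simp add: G_def)
    then have lim: "(\<lambda>n. \<Sum>i<M. real (card {m \<in> {1..n}. m \<in> G i}) / real n) \<longlonglongrightarrow> (\<Sum>i<M. 0)"
      by (intro tendsto_sum)
    \<comment> \<open>For \<open>n = 0\<close> the quotients are 0 by the convention for division by
      zero, hence the restriction to positive \<open>n\<close>.\<close>
    have "1 \<le> (\<Sum>i<M. real (card {m \<in> {1..n}. m \<in> G i}) / real n)" if "n \<ge> 1" for n
    proof -
      have "card {1..n} \<le> card (\<Union>i<M. {m \<in> {1..n}. m \<in> G i})"
        by (intro card_mono) (use cover in fastforce)+
      also have "\<dots> \<le> (\<Sum>i<M. card {m \<in> {1..n}. m \<in> G i})" by (rule card_UN_le) simp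
      finally have "real n \<le> (\<Sum>i<M. real (card {m \<in> {1..n}. m \<in> G i}))"
        unfolding of_nat_sum[symmetric] of_nat_le_iff by simp
      then show ?thesis using that by (simp add: sum_divide_distrib[symmetric])
    qed
    then have "1 \<le> (\<Sum>i<M. 0 :: real)" by (intro LIMSEQ_le_const[OF lim]) blast
    then show False by simp
  qed
  then obtain i where "\<not> uniformly_distributed_mod1 (s i)" ..
  then show ?thesis using cont per unfolding s_def by blast
qed

end
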